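(* Let $(E,(p_\alpha)_{\alpha\in\Lambda})$ be a Hausdorff commutative uniformly A-convex algebra with unit $e$, where $p_\alpha(e)=1$ for all $\alpha\in\Lambda$, and whose carrier space $M$ is nonempty. If $p_\alpha$ is submultiplicative for every $\alpha\in\Lambda$, then the following assertions are equivalent: (1) $E$ is saturated; (2) $E$ is a Cochran algebra; (3) $(E,(p_\alpha)_{\alpha\in\Lambda})$ is a uniform topological algebra, i.e. each $p_\alpha$ ($\alpha\in\Lambda$) is a uniform seminorm.
   Context: A locally convex algebra is a complex algebra with a locally convex topology for which multiplication is separately continuous. A locally convex algebra $E$ is uniformly A-convex if its topology is defined by a family $\{p_\alpha:\alpha\in\Lambda\}$ of seminorms such that for each $x\in E$ there is a positive constant $r_x$ (independent of $\alpha$) with $p_\alpha(xy)\le r_x p_\alpha(y)$ and $p_\alpha(yx)\le r_x p_\alpha(y)$ for all $\alpha\in\Lambda$ and $y\in E$. Writing $(E,(p_\alpha)_{\alpha\in\Lambda})$ means that $(p_\alpha)$ is such a defining family. A uniform seminorm on $E$ is a seminorm $p$ with $p(x^2)=p(x)^2$ for all $x\in E$. The carrier space $M=M(E)$ is the space of all nonzero continuous multiplicative linear functionals on $E$, with the weak topology (pointwise convergence on $E$). For $\alpha\in\Lambda$ and $m\in M$, define the extended real number $t_\alpha(m)=\sup\{|m(x)| : x\in E,\ p_\alpha(x)\le 1\}$, and set $\phi_\alpha(m)=t_\alpha(m)^{-1}$ if $t_\alpha(m)<\infty$ and $\phi_\alpha(m)=0$ otherwise. Put $M_\alpha=\{m\in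 M : t_\alpha(m)<\infty\}$. For $x\in E$, $\hat x:M\to\mathbb{C}$, $\hat x(m)=m(x)$, is its Gelfand transform; it is bounded and continuous on $M$. For a bounded continuous $f:M\to\mathbb{C}$, $\hat p_\alpha(f)=\sup\{\phi_\alpha(m)|f(m)| : m\in M\}$. $E$ is called a Cochran algebra if $\hat p_\alpha(\hat x)=p_\alpha(x)$ for all $\alpha\in\Lambda$ and $x\in E$. $E$ is called saturated if for each $\alpha\in\Lambda$ and $x\in E$ such that $p_\alpha(x)=1$ there exists $m_0\in M$ such that $|m_0(x)|=\sup\{|m_0(y)| : y\in E,\ p_\alpha(y)\le 1\}$, i.e. $m_0\in M_\alpha$ and $t_\alpha(m_0)^{-1}|m_0(x)|=1$. *)

theory Defs
  imports "HOL-Analysis.Analysis"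
begin

text \<open>Algebras need not be commutative or unital here. There is no type class for complex vector
  spaces, so scalar multiplication is an explicit parameter.\<close>

locale complex_algebra = vector_space sc
  for sc :: "complex \<Rightarrow> 'a::ring \<Rightarrow> 'a" +
  assumes scale_mult_left: "sc c x * y = sc c (x * y)"
    and scale_mult_right: "x * sc c y = sc c (x * y)"

definition seminorm :: "(complex \<Rightarrow> 'a::ab_group_add \<Rightarrow> 'a) \<Rightarrow> ('a \<Rightarrow> real) \<Rightarrow> bool" where
  "seminorm sc q \<longleftrightarrow>
     (\<forall>x. 0 \<le> q x) \<and> (\<forall>x y. q (x + y) \<le> q x + q y) \<and> (\<forall>c x. q (sc c x) = cmod c * q x)"

text \<open>Inserting the whole space only matters for the empty family, which then yields the
  indiscrete topology.\<close>

definition seminorm_topology :: "'i set \<Rightarrow> ('i \<Rightarrow> 'a::ab_group_add \<Rightarrow> real) \<Rightarrow> 'a topology" where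
  "seminorm_topology \<Lambda> p =
     topology_generated_by
       (insert UNIV {{y. p \<alpha> (y - x) < \<epsilon>} | \<alpha> x \<epsilon>. \<alpha> \<in> \<Lambda> \<and> 0 < \<epsilon>})"

definition locally_convex_algebra ::
    "(complex \<Rightarrow> 'a::ring \<Rightarrow> 'a) \<Rightarrow> 'a topology \<Rightarrow> bool" where
  "locally_convex_algebra sc T \<longleftrightarrow>
     complex_algebra sc \<and>
     (\<exists>Q. (\<forall>q\<in>Q. seminorm sc q) \<and> T = seminorm_topology Q (\<lambda>q. q)) \<and>
     (\<forall>x. continuous_map T T (\<lambda>y. x * y) \<and> continuous_map T T (\<lambda>y. y * x))"

definition uniformly_A_convex_algebra ::
    "(complex \<Rightarrow> 'a::ring \<Rightarrow> 'a) \<Rightarrow> 'a topology \<Rightarrow> 'i set \<Rightarrow> ('i \<Rightarrow> 'a \<Rightarrow> real) \<Rightarrow> bool" where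
  "uniformly_A_convex_algebra sc T \<Lambda> p \<longleftrightarrow>
     locally_convex_algebra sc T \<and>
     (\<forall>\<alpha>\<in>\<Lambda>. seminorm sc (p \<alpha>)) \<and> T = seminorm_topology \<Lambda> p \<and>
     (\<forall>x. \<exists>r>0. \<forall>\<alpha>\<in>\<Lambda>. \<forall>y. p \<alpha> (x * y) \<le> r * p \<alpha> y \<and> p \<alpha> (y * x) \<le> r * p \<alpha> y)"

definition submultiplicative :: "('a::ring \<Rightarrow> real) \<Rightarrow> bool" where
  "submultiplicative q \<longleftrightarrow> (\<forall>x y. q (x * y) \<le> q x * q y)"

definition uniform_seminorm :: "(complex \<Rightarrow> 'a::ring \<Rightarrow> 'a) \<Rightarrow> ('a \<Rightarrow> real) \<Rightarrow> bool" where
  "uniform_seminorm sc q \<longleftrightarrow> seminorm sc q \<and> (\<forall>x. q (x * x) = (q x)\<^sup>2)"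

definition carrier_space ::
    "(complex \<Rightarrow> 'a::ring \<Rightarrow> 'a) \<Rightarrow> 'a topology \<Rightarrow> ('a \<Rightarrow> complex) set" where
  "carrier_space sc T =
     {m. Vector_Spaces.linear sc (*) m \<and> (\<forall>x y. m (x * y) = m x * m y) \<and>
         continuous_map T euclidean m \<and> m \<noteq> (\<lambda>x. 0)}"

definition gelfand :: "'a \<Rightarrow> ('a \<Rightarrow> complex) \<Rightarrow> complex" where
  "gelfand x m = m x"

text \<open>In the next three definitions \<open>q\<close> is a single seminorm of the defining family, so that
  \<open>functional_bound (p \<alpha>)\<close>, \<open>weight (p \<alpha>)\<close> and \<open>weighted_sup M (p \<alpha>)\<close> are
  the usual $t_\alpha$, $\phi_\alpha$ and $\hat p_\alpha$.\<close>

definition functional_bound :: "('a \<Rightarrow> real) \<Rightarrow> ('a \<Rightarrow> complex) \<Rightarrow> ereal" where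
  "functional_bound q m = (SUP x\<in>{x. q x \<le> 1}. ereal (cmod (m x)))"

definition weight :: "('a \<Rightarrow> real) \<Rightarrow> ('a \<Rightarrow> complex) \<Rightarrow> real" where
  "weight q m =
     (if functional_bound q m < \<infinity> then inverse (real_of_ereal (functional_bound q m)) else 0)"

text \<open>The supremum is taken in the extended reals, so no boundedness of \<open>f\<close> has to be
  presupposed; on bounded functions it is the usual real supremum.\<close>

definition weighted_sup ::
    "('a \<Rightarrow> complex) set \<Rightarrow> ('a \<Rightarrow> real) \<Rightarrow> (('a \<Rightarrow> complex) \<Rightarrow> complex) \<Rightarrow> ereal" where
  "weighted_sup M q f = (SUP m\<in>M. ereal (weight q m * cmod (f m)))"

definition Cochran_algebra ::
    "(complex \<Rightarrow> 'a::ring \<Rightarrow> 'a) \<Rightarrow> 'a topology \<Rightarrow> 'i set \<Rightarrow> ('i \<Rightarrow> 'a \<Rightarrow> real) \<Rightarrow> bool" where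
  "Cochran_algebra sc T \<Lambda> p \<longleftrightarrow>
     (\<forall>\<alpha>\<in>\<Lambda>. \<forall>x. weighted_sup (carrier_space sc T) (p \<alpha>) (gelfand x) = ereal (p \<alpha> x))"

definition saturated ::
    "(complex \<Rightarrow> 'a::ring \<Rightarrow> 'a) \<Rightarrow> 'a topology \<Rightarrow> 'i set \<Rightarrow> ('i \<Rightarrow> 'a \<Rightarrow> real) \<Rightarrow> bool" where
  "saturated sc T \<Lambda> p \<longleftrightarrow>
     (\<forall>\<alpha>\<in>\<Lambda>. \<forall>x. p \<alpha> x = 1 \<longrightarrow>
        (\<exists>m\<in>carrier_space sc T. ereal (cmod (m x)) = functional_bound (p \<alpha>) m))"

definition uniform_topological_algebra ::
    "(complex \<Rightarrow> 'a::ring \<Rightarrow> 'a) \<Rightarrow> 'i set \<Rightarrow> ('i \<Rightarrow> 'a \<Rightarrow> real) \<Rightarrow> bool" where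
  "uniform_topological_algebra sc \<Lambda> p \<longleftrightarrow> (\<forall>\<alpha>\<in>\<Lambda>. uniform_seminorm sc (p \<alpha>))"

end

theory Submission
  imports Defs
begin

text \<open>
  For a submultiplicative seminorm \<open>p\<close> with \<open>p 1 = 1\<close>, a character that is bounded on the unit
  ball of \<open>p\<close> is bounded by \<open>1\<close> there, since the ball is closed under powers, and it takes the
  value \<open>1\<close> at the unit. So \<open>functional_bound p m\<close> is \<open>1\<close> or \<open>\<infinity>\<close> and the weights are \<open>1\<close> or \<open>0\<close>
  (\<open>weight_character\<close>). Hence the weighted supremum of a Gelfand transform is the supremum of
  \<open>\<bar>m x\<bar>\<close> over the characters dominated by \<open>p\<close>. It never exceeds \<open>p x\<close>. Saturation says, after
  scaling, that the value \<open>p x\<close> is attained whenever it is positive; as the carrier space is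
  nonempty, a saturated algebra is therefore a Cochran algebra. Such suprema
  respect squares, so in a Cochran algebra every seminorm of the family is uniform.

  What remains is that uniformity implies saturation: if \<open>p\<close> is uniform and \<open>p x = 1\<close>, some
  character dominated by \<open>p\<close> has modulus \<open>1\<close> at \<open>x\<close>. The proof avoids completions and spectral
  theory. By Zorn's lemma there is a minimal seminorm \<open>q\<close> among the uniform submultiplicative
  seminorms below \<open>p\<close> with value \<open>1\<close> at \<open>x\<close>. The localization \<open>a \<mapsto> lim q (a * b ^ n) / q b ^ n\<close>,
  taken first at \<open>b = x\<close> and then at any \<open>b\<close> with \<open>q b > 0\<close>, produces seminorms of the same kind
  below \<open>q\<close>, so that minimality forces \<open>q\<close> to be multiplicative
  (\<open>multiplicative_seminorm_below_uniform\<close>). An elementary form of the Gelfand--Mazur theorem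
  (\<open>multiplicative_seminorm_Gelfand_Mazur\<close>) then yields for every \<open>a\<close> a scalar \<open>m a\<close> with
  \<open>q (a - m a) = 0\<close>, and \<open>m\<close> is a character with \<open>\<bar>m a\<bar> = q a\<close>.
\<close>

section \<open>Uniform submultiplicative seminorms\<close>

lemma seminormD:
  assumes "seminorm sc q"
  shows "0 \<le> q x" "q (x + y) \<le> q x + q y" "q (sc c x) = cmod c * q x"
  using assms by (auto simp: seminorm_def)

lemma submultiplicativeD: "submultiplicative q \<Longrightarrow> q (x * y) \<le> q x * q y"
  by (simp add: submultiplicative_def)

lemma uniform_seminormD:
  assumes "uniform_seminorm sc q"
  shows "seminorm sc q" "q (x * x) = (q x)\<^sup>2"
  using assms by (auto simp: uniform_seminorm_def)

lemma uniform_seminorm_power: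
  fixes q :: "'a::comm_ring_1 \<Rightarrow> real"
  assumes us: "uniform_seminorm sc q" and sub: "submultiplicative q" and b: "0 < q b"
  shows "q (b ^ n) = q b ^ n"
proof -
  note nonneg = seminormD(1)[OF uniform_seminormD(1)[OF us]]
  have "q 1 = q 1 * q 1"
    using uniform_seminormD(2)[OF us, of 1] by (simp add: power2_eq_square)
  then have q1: "q 1 \<le> 1" by (cases "q 1 = 0") auto
  have upper: "q (b ^ j) \<le> q b ^ j" for j
  proof (induction j)
    case (Suc j)
    have "q (b ^ Suc j) \<le> q b * q (b ^ j)"
      using submultiplicativeD[OF sub, of b "b ^ j"] by simp
    also have "\<dots> \<le> q b * q b ^ j"
      using Suc nonneg by (intro mult_left_mono)
    finally show ?case by simp
  qed (simp add: q1)
  have two: "q (b ^ (2 ^ k)) = q b ^ (2 ^ k)" for k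
  proof (induction k)
    case (Suc k)
    then show ?case
      using uniform_seminormD(2)[OF us, of "b ^ (2 ^ k)"]
      by (simp add: mult_2 power_add power2_eq_square)
  qed simp
  \<comment> \<open>Squeeze \<open>n\<close> below a power of two.\<close>
  obtain j where j: "2 ^ n = n + j"
    using less_imp_le[OF less_exp[of n]] by (metis le_iff_add)
  have "q b ^ n * q b ^ j = q (b ^ n * b ^ j)"
    using two[of n] by (simp add: j power_add)
  also have "\<dots> \<le> q (b ^ n) * q (b ^ j)"
    by (rule submultiplicativeD[OF sub])
  also have "\<dots> \<le> q (b ^ n) * q b ^ j"
    using upper nonneg by (intro mult_left_mono)
  finally have "q b ^ n \<le> q (b ^ n)"
    using b by simp
  with upper[of n] show ?thesis by simp
qed

text \<open>Lower bounds of chains, as needed for Zorn's lemma.\<close>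

lemma uniform_seminorm_chain_INF:
  fixes sc :: "complex \<Rightarrow> 'a::ring \<Rightarrow> 'a"
  assumes ne: "C \<noteq> {}"
    and us: "\<And>q. q \<in> C \<Longrightarrow> uniform_seminorm sc q"
    and sub: "\<And>q. q \<in> C \<Longrightarrow> submultiplicative q"
    and chain: "\<And>q r. q \<in> C \<Longrightarrow> r \<in> C \<Longrightarrow> q \<le> r \<or> r \<le> q"
  defines "u \<equiv> \<lambda>a. INF q\<in>C. q a"
  shows "uniform_seminorm sc u" "submultiplicative u"
proof -
  have nonneg: "0 \<le> q a" if "q \<in> C" for q a
    using us[OF that] seminormD(1) uniform_seminormD(1) by blast
  have lower: "u a \<le> q a" if "q \<in> C" for q a
    unfolding u_def by (rule cINF_lower) (use nonneg that in \<open>auto intro!: bdd_belowI2[of _ 0]\<close>)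
  have greatest: "c \<le> u a" if "\<And>q. q \<in> C \<Longrightarrow> c \<le> q a" for c a
    unfolding u_def using ne that by (auto intro!: cINF_greatest)
  have u0: "0 \<le> u a" for a
    using nonneg by (rule greatest)
  have scaled: "c \<le> k * u a" if "\<And>q. q \<in> C \<Longrightarrow> c \<le> k * q a" "0 \<le> k" for c k a
  proof (cases "k = 0")
    case True
    with that ne show ?thesis by auto
  next
    case False
    with \<open>0 \<le> k\<close> have "c / k \<le> u a"
      using that(1) by (intro greatest) (simp add: field_simps)
    with False \<open>0 \<le> k\<close> show ?thesis by (simp add: field_simps)
  qed
  have add: "u (a + b) \<le> u a + u b" for a b
  proof -
    have *: "u (a + b) \<le> q a + r b" if qr: "q \<in> C" "r \<in> C" for q r
    proof -
      \<comment> \<open>The smaller of the two seminorms bounds the left-hand side.\<close>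
      obtain s where s: "s \<in> C" "s \<le> q" "s \<le> r"
        using chain[OF qr] qr by blast
      have "u (a + b) \<le> s a + s b"
        using lower[OF s(1)] seminormD(2)[OF uniform_seminormD(1)[OF us[OF s(1)]]]
        by (meson order_trans)
      also have "\<dots> \<le> q a + r b"
        using s by (intro add_mono) (auto simp: le_fun_def)
      finally show ?thesis .
    qed
    have "u (a + b) - r b \<le> u a" if "r \<in> C" for r
      using *[OF _ that] by (intro greatest) (simp add: algebra_simps)
    then have "u (a + b) - u a \<le> u b"
      by (intro greatest) (simp add: algebra_simps)
    then show ?thesis by simp
  qed
  have mult: "u (a * b) \<le> u a * u b" for a b
  proof -
    have *: "u (a * b) \<le> q a * r b" if qr: "q \<in> C" "r \<in> C" for q r
    proof -
      obtain s where s: "s \<in> C" "s \<le> q" "s \<le> r"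
        using chain[OF qr] qr by blast
      have "u (a * b) \<le> s a * s b"
        using lower[OF s(1)] submultiplicativeD[OF sub[OF s(1)]] by (meson order_trans)
      also have "\<dots> \<le> q a * r b"
        using s nonneg by (intro mult_mono) (auto simp: le_fun_def qr)
      finally show ?thesis .
    qed
    have "u (a * b) \<le> r b * u a" if "r \<in> C" for r
      using *[OF _ that] nonneg[OF that] by (intro scaled) (simp_all add: mult.commute)
    then have "u (a * b) \<le> u a * u b"
      using u0 by (intro scaled) (simp_all add: mult.commute)
    then show ?thesis .
  qed
  have scale: "u (sc c a) = cmod c * u a" for c a
  proof (rule antisym)
    have eq: "q (sc c a) = cmod c * q a" if "q \<in> C" for q
      using seminormD(3)[OF uniform_seminormD(1)[OF us[OF that]]] .
    show "u (sc c a) \<le> cmod c * u a"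
      using lower eq by (intro scaled) (metis, simp)
    show "cmod c * u a \<le> u (sc c a)"
      by (intro greatest) (simp add: eq lower mult_left_mono)
  qed
  have square: "u (a * a) = (u a)\<^sup>2" for a
  proof (rule antisym)
    show "u (a * a) \<le> (u a)\<^sup>2"
      using mult[of a a] by (simp add: power2_eq_square)
    show "(u a)\<^sup>2 \<le> u (a * a)"
    proof (rule greatest)
      fix q assume "q \<in> C"
      then show "(u a)\<^sup>2 \<le> q (a * a)"
        using power_mono[OF lower u0] uniform_seminormD(2)[OF us] by metis
    qed
  qed
  show "uniform_seminorm sc u"
    using u0 add scale square by (auto simp: uniform_seminorm_def seminorm_def)
  show "submultiplicative u"
    using mult by (simp add: submultiplicative_def)
qed

text \<open>Localization of a submultiplicative seminorm \<open>q\<close> at an element \<open>b\<close> with \<open>q b > 0\<close>: the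
  largest seminorm below \<open>q\<close> for which multiplication by \<open>b\<close> scales by exactly \<open>q b\<close>. The limit
  exists because the sequence is decreasing. If \<open>q b = 0\<close>, the value is \<open>0\<close> by
  division by zero.\<close>

definition localized_seminorm :: "('a::comm_ring_1 \<Rightarrow> real) \<Rightarrow> 'a \<Rightarrow> 'a \<Rightarrow> real" where
  "localized_seminorm q b a = lim (\<lambda>n. q (a * b ^ n) / q b ^ n)"

context
  fixes sc :: "complex \<Rightarrow> 'a::comm_ring_1 \<Rightarrow> 'a" and q :: "'a \<Rightarrow> real" and b :: 'a
  assumes alg: "complex_algebra sc"
    and us: "uniform_seminorm sc q" and sub: "submultiplicative q" and b: "0 < q b"
begin

lemma decseq_localized: "decseq (\<lambda>n. q (a * b ^ n) / q b ^ n)"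
proof (rule decseq_SucI)
  fix n
  have "q (a * b ^ Suc n) \<le> q (a * b ^ n) * q b"
    using submultiplicativeD[OF sub, of "a * b ^ n" b] by (simp add: mult_ac)
  then show "q (a * b ^ Suc n) / q b ^ Suc n \<le> q (a * b ^ n) / q b ^ n"
    using b by (simp add: field_simps)
qed

lemma localized_nonneg: "0 \<le> q (a * b ^ n) / q b ^ n"
  using seminormD(1)[OF uniform_seminormD(1)[OF us]] b by simp

lemma localized_tendsto:
  "(\<lambda>n. q (a * b ^ n) / q b ^ n) \<longlonglongrightarrow> localized_seminorm q b a"
proof -
  have "convergent (\<lambda>n. q (a * b ^ n) / q b ^ n)"
    using decseq_convergent[OF decseq_localized, of 0 a] localized_nonneg convergentI by metis
  then show ?thesis
    unfolding localized_seminorm_def by (simp add: convergent_LIMSEQ_iff)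
qed

lemma localized_tendsto_even:
  "(\<lambda>n. q (a * b ^ (2 * n)) / q b ^ (2 * n)) \<longlonglongrightarrow> localized_seminorm q b a"
  using LIMSEQ_subseq_LIMSEQ[OF localized_tendsto, of "\<lambda>n. 2 * n"]
  by (simp add: strict_mono_def o_def)

lemma localized_le: "localized_seminorm q b a \<le> q a"
  using decseq_ge[OF decseq_localized localized_tendsto, of a 0] by simp

lemma localized_mult_base: "localized_seminorm q b (a * b) = q b * localized_seminorm q b a"
proof (rule LIMSEQ_unique[OF localized_tendsto])
  have "(\<lambda>n. q b * (q (a * b ^ Suc n) / q b ^ Suc n)) \<longlonglongrightarrow> q b * localized_seminorm q b a"
    by (intro tendsto_intros LIMSEQ_Suc localized_tendsto)
  then show "(\<lambda>n. q (a * b * b ^ n) / q b ^ n) \<longlonglongrightarrow> q b * localized_seminorm q b a"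
    using b by (simp add: mult_ac)
qed

lemma localized_submultiplicative: "submultiplicative (localized_seminorm q b)"
  unfolding submultiplicative_def
proof (intro allI)
  fix x y
  show "localized_seminorm q b (x * y) \<le> localized_seminorm q b x * localized_seminorm q b y"
  proof (rule LIMSEQ_le[OF localized_tendsto_even tendsto_mult[OF localized_tendsto localized_tendsto]])
    have "q (x * y * b ^ (2 * n)) \<le> q (x * b ^ n) * q (y * b ^ n)" for n
      unfolding power_even_eq power2_eq_square using submultiplicativeD[OF sub, of "x * b ^ n" "y * b ^ n"]
      by (simp add: mult_ac)
    then have "q (x * y * b ^ (2 * n)) / q b ^ (2 * n)
        \<le> q (x * b ^ n) / q b ^ n * (q (y * b ^ n) / q b ^ n)" for n
      using b by (simp add: mult_2 power_add divide_right_mono)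
    then show "\<exists>N. \<forall>n\<ge>N. q (x * y * b ^ (2 * n)) / q b ^ (2 * n)
        \<le> q (x * b ^ n) / q b ^ n * (q (y * b ^ n) / q b ^ n)"
      by blast
  qed
qed

lemma localized_uniform_seminorm: "uniform_seminorm sc (localized_seminorm q b)"
  unfolding uniform_seminorm_def seminorm_def
proof (intro conjI allI)
  interpret complex_algebra sc by (rule alg)
  note sem = seminormD[OF uniform_seminormD(1)[OF us]]
  fix x y c
  show "0 \<le> localized_seminorm q b x"
    using LIMSEQ_le_const[OF localized_tendsto] localized_nonneg by blast
  show "localized_seminorm q b (x + y) \<le> localized_seminorm q b x + localized_seminorm q b y"
  proof (rule LIMSEQ_le[OF localized_tendsto tendsto_add[OF localized_tendsto localized_tendsto]])
    have "q ((x + y) * b ^ n) / q b ^ n \<le> q (x * b ^ n) / q b ^ n + q (y * b ^ n) / q b ^ n" for n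
      using sem(2)[of "x * b ^ n" "y * b ^ n"] b
      by (simp add: distrib_right divide_right_mono flip: add_divide_distrib)
    then show "\<exists>N. \<forall>n\<ge>N. q ((x + y) * b ^ n) / q b ^ n
        \<le> q (x * b ^ n) / q b ^ n + q (y * b ^ n) / q b ^ n"
      by blast
  qed
  show "localized_seminorm q b (sc c x) = cmod c * localized_seminorm q b x"
  proof (rule LIMSEQ_unique[OF localized_tendsto])
    have "(\<lambda>n. cmod c * (q (x * b ^ n) / q b ^ n)) \<longlonglongrightarrow> cmod c * localized_seminorm q b x"
      by (intro tendsto_intros localized_tendsto)
    then show "(\<lambda>n. q (sc c x * b ^ n) / q b ^ n) \<longlonglongrightarrow> cmod c * localized_seminorm q b x"
      by (simp add: scale_mult_left sem(3))
  qed
  show "localized_seminorm q b (x * x) = (localized_seminorm q b x)\<^sup>2"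
  proof (rule LIMSEQ_unique[OF localized_tendsto_even])
    have "q (x * x * b ^ (2 * n)) = (q (x * b ^ n))\<^sup>2" for n
      unfolding power_even_eq power2_eq_square using uniform_seminormD(2)[OF us, of "x * b ^ n"]
      by (simp add: mult_ac power2_eq_square)
    then have "q (x * x * b ^ (2 * n)) / q b ^ (2 * n) = (q (x * b ^ n) / q b ^ n)\<^sup>2" for n
      by (simp add: power_divide power_even_eq)
    then show "(\<lambda>n. q (x * x * b ^ (2 * n)) / q b ^ (2 * n)) \<longlonglongrightarrow> (localized_seminorm q b x)\<^sup>2"
      using tendsto_power[OF localized_tendsto, of x 2] by simp
  qed
qed

end

section \<open>Multiplicative seminorms below a uniform seminorm\<close>

text \<open>The element \<open>x\<close> is normalized by \<open>p x = 1\<close>; the multiplicative seminorm below \<open>p\<close> is chosen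
  to agree with \<open>p\<close> at that element.\<close>

lemma multiplicative_seminorm_below_uniform:
  fixes sc :: "complex \<Rightarrow> 'a::comm_ring_1 \<Rightarrow> 'a"
  assumes alg: "complex_algebra sc"
    and p: "uniform_seminorm sc p" "submultiplicative p" and x: "p x = 1"
  obtains q where "seminorm sc q" "\<And>a b. q (a * b) = q a * q b" "\<And>a. q a \<le> p a" "q x = 1"
proof -
  define A where
    "A = {q. uniform_seminorm sc q \<and> submultiplicative q \<and> q \<le> p \<and> q x = 1}"
  \<comment> \<open>Zorn's lemma for the reversed order gives a minimal element.\<close>
  have "\<exists>q\<in>A. \<forall>r\<in>A. r \<le> q \<longrightarrow> r = q"
  proof (rule predicate_Zorn)
    show "partial_order_on A (relation_of (\<lambda>q r. r \<le> q) A)"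
      by (rule partial_order_on_relation_ofI) auto
    fix C assume C: "C \<in> Chains (relation_of (\<lambda>q r. r \<le> q) A)"
    then have CA: "C \<subseteq> A" and chain: "\<And>q r. q \<in> C \<Longrightarrow> r \<in> C \<Longrightarrow> q \<le> r \<or> r \<le> q"
      by (auto simp: Chains_def relation_of_def)
    show "\<exists>u\<in>A. \<forall>a\<in>C. u \<le> a"
    proof (cases "C = {}")
      case True
      then show ?thesis using p x by (auto simp: A_def)
    next
      case False
      define u where "u = (\<lambda>a. INF q\<in>C. q a)"
      have us: "uniform_seminorm sc u" "submultiplicative u"
        unfolding u_def using CA
        by (intro uniform_seminorm_chain_INF False chain; auto simp: A_def)+
      have low: "u \<le> q" if "q \<in> C" for q
      proof (rule le_funI)
        fix a
        have "\<forall>r\<in>C. 0 \<le> r a"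
          using CA by (auto simp: A_def uniform_seminorm_def seminorm_def)
        then show "u a \<le> q a"
          unfolding u_def using that by (intro cINF_lower) (auto intro!: bdd_belowI2[of _ 0])
      qed
      have "(\<lambda>q. q x) ` C = {1}"
        using CA False by (auto simp: A_def)
      then have "u x = 1" by (simp add: u_def)
      moreover obtain r where "r \<in> C" using False by blast
      then have "u \<le> p"
        using order_trans[OF low] CA by (auto simp: A_def)
      ultimately have "u \<in> A" using us by (simp add: A_def)
      with low show ?thesis by blast
    qed
  qed
  then obtain q where q: "q \<in> A" and min: "\<And>r. r \<in> A \<Longrightarrow> r \<le> q \<Longrightarrow> r = q" by blast
  have us: "uniform_seminorm sc q" and sub: "submultiplicative q"
    and le: "q \<le> p" and qx: "q x = 1" using q by (auto simp: A_def)
  note loc = alg us sub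
  have loc_eq: "localized_seminorm q b = q" if "0 < q b" "localized_seminorm q b x = 1" for b
  proof (rule min)
    show below: "localized_seminorm q b \<le> q"
      by (rule le_funI) (rule localized_le[OF loc that(1)])
    show "localized_seminorm q b \<in> A"
      using localized_uniform_seminorm[OF loc that(1)]
        localized_submultiplicative[OF loc that(1)] that(2) order_trans[OF below le]
      by (simp add: A_def)
  qed
  \<comment> \<open>Localizing at \<open>x\<close> comes first: it is what keeps the value at \<open>x\<close> equal to \<open>1\<close> in all
    further localizations.\<close>
  have mult_x: "q (a * x) = q a" for a
  proof -
    have qx0: "0 < q x" by (simp add: qx)
    have one: "q (x * x ^ n) / q x ^ n = 1" for n
      using uniform_seminorm_power[OF us sub qx0, of "Suc n"] by (simp add: qx)
    have "localized_seminorm q x x = 1"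
      by (simp only: localized_seminorm_def one limI[OF tendsto_const])
    then have "localized_seminorm q x = q"
      by (intro loc_eq qx0)
    then show ?thesis
      using localized_mult_base[OF loc qx0, of a] by (simp add: qx)
  qed
  have mult: "q (a * b) = q a * q b" for a b
  proof (cases "q b = 0")
    case True
    then show ?thesis
      using submultiplicativeD[OF sub, of a b] seminormD(1)[OF uniform_seminormD(1)[OF us], of "a * b"]
      by simp
  next
    case False
    then have b: "0 < q b"
      using seminormD(1)[OF uniform_seminormD(1)[OF us], of b] by simp
    have one: "q (x * b ^ n) / q b ^ n = 1" for n
      using mult_x[of "b ^ n"] uniform_seminorm_power[OF us sub b, of n] b
      by (simp add: mult.commute)
    have "localized_seminorm q b x = 1"
      by (simp only: localized_seminorm_def one limI[OF tendsto_const])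
    then have "localized_seminorm q b = q"
      by (intro loc_eq b)
    then show ?thesis
      using localized_mult_base[OF loc b, of a] by simp
  qed
  show ?thesis
    using that us mult le qx by (metis le_funD uniform_seminormD(1))
qed

section \<open>Characters\<close>

text \<open>The Gelfand--Mazur theorem for a multiplicative seminorm, where scalars are identified with
  multiples of the unit. If \<open>\<rho>\<close> is the minimum of
  \<open>q (a - \<zeta>)\<close> over all scalars and \<open>b = a - \<zeta>\<close> attains it, then for every \<open>\<mu>\<close> the
  factorization of \<open>b ^ N - \<mu> ^ N\<close>, \<open>N = 2 ^ k\<close>, gives
  \<open>q (b - \<mu>) \<rho> ^ (N - 1) \<le> \<rho> ^ N + \<bar>\<mu>\<bar> ^ N\<close>. If \<open>\<rho> > 0\<close>, then letting \<open>k\<close> grow shows that the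
  minimum is also attained at \<open>\<zeta> + \<mu>\<close> whenever \<open>\<bar>\<mu>\<bar> < \<rho>\<close>, hence along a whole ray, which is
  absurd for large scalars.\<close>

lemma multiplicative_seminorm_Gelfand_Mazur:
  fixes sc :: "complex \<Rightarrow> 'a::comm_ring_1 \<Rightarrow> 'a"
  assumes alg: "complex_algebra sc" and sem: "seminorm sc q"
    and mult: "\<And>a b. q (a * b) = q a * q b" and q1: "q 1 = 1"
  shows "\<exists>\<zeta>. q (a - sc \<zeta> 1) = 0"
proof -
  interpret complex_algebra sc by (rule alg)
  define h where "h c = sc c 1" for c
  have h_diff: "h (c - d) = h c - h d" and h_add: "h (c + d) = h c + h d"
    and h_mult: "h (c * d) = h c * h d" and h0: "h 0 = 0" for c d
    by (simp_all add: h_def scale_left_diff_distrib scale_left_distrib scale_mult_left)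
  have qh: "q (h c) = cmod c" for c
    by (simp add: h_def seminormD(3)[OF sem] q1)
  have q_pow: "q (b ^ n) = q b ^ n" for b n
    by (induction n) (simp_all add: q1 mult)
  note nonneg = seminormD(1)[OF sem] and tri = seminormD(2)[OF sem]
  have q_minus: "q (- y) = q y" for y
    using seminormD(3)[OF sem, of "-1" y] by simp
  have tri': "q (y - z) \<le> q y + q z" for y z
    using tri[of y "- z"] by (simp add: q_minus)
  \<comment> \<open>The function \<open>f\<close> is Lipschitz and tends to infinity, so it has a minimum on the plane.\<close>
  define f where "f \<zeta> = q (a - h \<zeta>)" for \<zeta>
  have f_lip: "f \<zeta> \<le> f \<mu> + cmod (\<zeta> - \<mu>)" for \<zeta> \<mu>
    using tri'[of "a - h \<mu>" "h (\<zeta> - \<mu>)"] unfolding f_def qh by (simp add: h_diff)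
  have f_ge: "cmod \<zeta> - q a \<le> f \<zeta>" for \<zeta>
    using tri'[of a "a - h \<zeta>"] qh[of \<zeta>] unfolding f_def by simp
  have "continuous_on UNIV f"
    unfolding continuous_on_iff
  proof (intro ballI allI impI)
    fix x :: complex and e :: real assume "0 < e"
    have "dist (f y) (f x) \<le> dist y x" for y
      using f_lip[of x y] f_lip[of y x] by (simp add: dist_norm norm_minus_commute abs_le_iff)
    then show "\<exists>d>0. \<forall>y\<in>UNIV. dist y x < d \<longrightarrow> dist (f y) (f x) < e"
      using \<open>0 < e\<close> by (meson le_less_trans)
  qed
  then have cont: "continuous_on (cball 0 (2 * q a)) f"
    by (rule continuous_on_subset) simp
  have "cball (0 :: complex) (2 * q a) \<noteq> {}" using nonneg[of a] by simp
  then obtain \<zeta>\<^sub>0 where \<zeta>\<^sub>0: "\<And>\<zeta>. \<zeta> \<in> cball 0 (2 * q a) \<Longrightarrow> f \<zeta>\<^sub>0 \<le> f \<zeta>"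
    using continuous_attains_inf[OF compact_cball _ cont] by blast
  define \<rho> where "\<rho> = f \<zeta>\<^sub>0"
  have min: "\<rho> \<le> f \<zeta>" for \<zeta>
  proof (cases "cmod \<zeta> \<le> 2 * q a")
    case True
    then show ?thesis unfolding \<rho>_def by (intro \<zeta>\<^sub>0) simp
  next
    case False
    have "\<rho> \<le> f 0" unfolding \<rho>_def by (intro \<zeta>\<^sub>0) (simp add: nonneg)
    also have "\<dots> \<le> f \<zeta>" using f_ge[of \<zeta>] False by (simp add: f_def h0)
    finally show ?thesis .
  qed
  have "\<rho> = 0"
  proof (rule ccontr)
    assume "\<rho> \<noteq> 0"
    then have \<rho>: "0 < \<rho>" using nonneg by (simp add: \<rho>_def f_def less_le)
    have step: "f (\<zeta> + \<mu>) = \<rho>" if \<zeta>: "f \<zeta> = \<rho>" and \<mu>: "cmod \<mu> < \<rho>" for \<zeta> \<mu>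
    proof -
      define b where "b = a - h \<zeta>"
      have qb: "q b = \<rho>" using \<zeta> by (simp add: b_def f_def)
      have lower: "\<rho> \<le> q (b - h \<nu>)" for \<nu>
        using min[of "\<zeta> + \<nu>"] by (simp add: b_def f_def h_add algebra_simps)
      \<comment> \<open>Square roots of scalars split \<open>b ^ (2 ^ k) - w\<close> into factors of the form \<open>b - \<nu>\<close>.\<close>
      have lower_pow: "\<rho> ^ (2 ^ k) \<le> q (b ^ (2 ^ k) - h w)" for k w
      proof (induction k arbitrary: w)
        case (Suc k)
        define s where "s = csqrt w"
        have w: "w = s * s" using power2_csqrt[of w] by (simp add: s_def power2_eq_square)
        have "b ^ (2 ^ Suc k) - h w = (b ^ (2 ^ k) - h s) * (b ^ (2 ^ k) - h (- s))"
          using h_diff[of 0 s] by (simp add: w h_mult h0 algebra_simps mult_2 power_add)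
        then have "q (b ^ (2 ^ Suc k) - h w)
            = q (b ^ (2 ^ k) - h s) * q (b ^ (2 ^ k) - h (- s))"
          by (simp only: mult)
        moreover have "\<rho> ^ (2 ^ Suc k) = \<rho> ^ (2 ^ k) * \<rho> ^ (2 ^ k)"
          by (simp add: mult_2 power_add)
        ultimately show ?case
          using Suc[of s] Suc[of "- s"] \<rho> by (simp add: mult_mono')
      qed (use lower in simp)
      have factor: "q (b - h \<mu>) * \<rho> ^ (2 ^ k) \<le> \<rho> * q (b ^ (2 ^ k) - h (\<mu> ^ (2 ^ k)))" for k
      proof (induction k)
        case (Suc k)
        let ?N = "2 ^ k :: nat"
        have "b ^ (2 ^ Suc k) - h (\<mu> ^ (2 ^ Suc k))
            = (b ^ ?N - h (\<mu> ^ ?N)) * (b ^ ?N - h (- (\<mu> ^ ?N)))"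
          using h_diff[of 0 "\<mu> ^ ?N"] by (simp add: h_mult h0 algebra_simps mult_2 power_add)
        then have eq: "q (b ^ (2 ^ Suc k) - h (\<mu> ^ (2 ^ Suc k)))
            = q (b ^ ?N - h (\<mu> ^ ?N)) * q (b ^ ?N - h (- (\<mu> ^ ?N)))"
          by (simp only: mult)
        have "q (b - h \<mu>) * \<rho> ^ (2 ^ Suc k) = (q (b - h \<mu>) * \<rho> ^ ?N) * \<rho> ^ ?N"
          by (simp add: mult_2 power_add)
        also have "\<dots> \<le> (\<rho> * q (b ^ ?N - h (\<mu> ^ ?N))) * q (b ^ ?N - h (- (\<mu> ^ ?N)))"
          using \<rho> nonneg by (intro mult_mono[OF Suc lower_pow]) auto
        finally show ?case by (simp only: eq mult.assoc)
      qed (simp add: mult.commute)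
      have bound: "q (b - h \<mu>) \<le> \<rho> * (1 + (cmod \<mu> / \<rho>) ^ (2 ^ k))" for k
      proof -
        let ?N = "2 ^ k :: nat"
        have "q (b ^ ?N - h (\<mu> ^ ?N)) \<le> \<rho> ^ ?N + cmod \<mu> ^ ?N"
          using tri'[of "b ^ ?N" "h (\<mu> ^ ?N)"] by (simp add: q_pow qb qh norm_power)
        then have "q (b - h \<mu>) * \<rho> ^ ?N \<le> \<rho> * (\<rho> ^ ?N + cmod \<mu> ^ ?N)"
          using factor[of k] \<rho> by (meson less_imp_le mult_left_mono order_trans)
        also have "\<dots> = \<rho> * (1 + (cmod \<mu> / \<rho>) ^ ?N) * \<rho> ^ ?N"
          using \<rho> by (simp add: field_simps)
        finally show ?thesis using \<rho> by simp
      qed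
      have "(\<lambda>k. (cmod \<mu> / \<rho>) ^ (2 ^ k)) \<longlonglongrightarrow> 0"
        using LIMSEQ_subseq_LIMSEQ[OF LIMSEQ_power_zero[of "cmod \<mu> / \<rho>"], of "\<lambda>k. 2 ^ k"] \<mu> \<rho>
        by (simp add: strict_mono_def o_def)
      then have "(\<lambda>k. \<rho> * (1 + (cmod \<mu> / \<rho>) ^ (2 ^ k))) \<longlonglongrightarrow> \<rho> * (1 + 0)"
        by (intro tendsto_intros)
      then have "q (b - h \<mu>) \<le> \<rho>"
        using LIMSEQ_le_const[of _ "\<rho> * (1 + 0)" "q (b - h \<mu>)"] bound by auto
      with lower[of \<mu>] show ?thesis
        by (simp add: b_def f_def h_add algebra_simps)
    qed
    have iter: "f (\<zeta>\<^sub>0 + of_real (n * (\<rho> / 2))) = \<rho>" for n :: nat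
    proof (induction n)
      case (Suc n)
      have "cmod (of_real (\<rho> / 2)) < \<rho>" using \<rho> by (simp add: norm_divide)
      from step[OF Suc this] show ?case
        by (simp add: algebra_simps add_divide_distrib)
    qed (simp add: \<rho>_def)
    obtain n :: nat where n: "\<rho> + q a + cmod \<zeta>\<^sub>0 < n * (\<rho> / 2)"
      using ex_less_of_nat_mult[of "\<rho> / 2" "\<rho> + q a + cmod \<zeta>\<^sub>0"] \<rho> by (metis half_gt_zero)
    have "n * (\<rho> / 2) = cmod (of_real (n * (\<rho> / 2)))"
      using \<rho> by (simp only: norm_of_real) simp
    also have "\<dots> \<le> cmod (\<zeta>\<^sub>0 + of_real (n * (\<rho> / 2))) + cmod \<zeta>\<^sub>0"
      using norm_triangle_ineq4[of "\<zeta>\<^sub>0 + of_real (n * (\<rho> / 2))" "\<zeta>\<^sub>0"] by simp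
    also have "\<dots> \<le> \<rho> + q a + cmod \<zeta>\<^sub>0"
      using f_ge[of "\<zeta>\<^sub>0 + of_real (n * (\<rho> / 2))"] iter[of n] by simp
    finally show False using n by simp
  qed
  then show ?thesis by (auto simp: \<rho>_def f_def h_def)
qed

lemma character_of_multiplicative_seminorm:
  fixes sc :: "complex \<Rightarrow> 'a::comm_ring_1 \<Rightarrow> 'a"
  assumes alg: "complex_algebra sc" and sem: "seminorm sc q"
    and mult: "\<And>a b. q (a * b) = q a * q b" and q1: "q 1 = 1"
  obtains m where "Vector_Spaces.linear sc (*) m" "\<And>a b. m (a * b) = m a * m b"
    "\<And>a. cmod (m a) = q a"
proof -
  interpret complex_algebra sc by (rule alg)
  note nonneg = seminormD(1)[OF sem] and tri = seminormD(2)[OF sem] and hom = seminormD(3)[OF sem]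
  obtain m where m: "\<And>a. q (a - sc (m a) 1) = 0"
    using multiplicative_seminorm_Gelfand_Mazur[OF alg sem mult q1] by metis
  have null_add: "q (y + z) = 0" if "q y = 0" "q z = 0" for y z
    using tri[of y z] nonneg[of "y + z"] that by simp
  have null_scale: "q (sc c y) = 0" if "q y = 0" for c y
    using that by (simp add: hom)
  have null_minus: "q (- y) = 0" if "q y = 0" for y
    using null_scale[OF that, of "-1"] by simp
  have unique: "m a = c" if "q (a - sc c 1) = 0" for a c
  proof -
    have eq: "sc (c - m a) 1 = (a - sc (m a) 1) + - (a - sc c 1)"
      by (simp add: scale_left_diff_distrib)
    have "q (sc (c - m a) 1) = 0"
      unfolding eq by (rule null_add[OF m null_minus[OF that]])
    then show ?thesis by (simp add: hom q1)
  qed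
  have add: "m (a + b) = m a + m b" for a b
  proof (rule unique)
    have eq: "a + b - sc (m a + m b) 1 = (a - sc (m a) 1) + (b - sc (m b) 1)"
      by (simp add: scale_left_distrib)
    show "q (a + b - sc (m a + m b) 1) = 0"
      unfolding eq by (rule null_add[OF m m])
  qed
  have scale: "m (sc c a) = c * m a" for c a
  proof (rule unique)
    have eq: "sc c a - sc (c * m a) 1 = sc c (a - sc (m a) 1)"
      by (simp add: scale_right_diff_distrib)
    show "q (sc c a - sc (c * m a) 1) = 0"
      unfolding eq by (rule null_scale[OF m])
  qed
  have prod: "m (a * b) = m a * m b" for a b
  proof (rule unique)
    have eq: "a * b - sc (m a * m b) 1 = (a - sc (m a) 1) * b + sc (m a) (b - sc (m b) 1)"
      by (simp add: scale_right_diff_distrib left_diff_distrib scale_mult_left)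
    have "q ((a - sc (m a) 1) * b) = 0"
      by (simp add: mult m)
    then show "q (a * b - sc (m a * m b) 1) = 0"
      unfolding eq by (rule null_add[OF _ null_scale[OF m]])
  qed
  have norm: "cmod (m a) = q a" for a
  proof (rule antisym)
    have eq: "q (sc (m a) 1) = cmod (m a)" by (simp add: hom q1)
    show "q a \<le> cmod (m a)"
      using tri[of "a - sc (m a) 1" "sc (m a) 1"] by (simp add: m eq)
    show "cmod (m a) \<le> q a"
      using tri[of a "- (a - sc (m a) 1)"] null_minus[OF m, of a] by (simp add: eq)
  qed
  have "Vector_Spaces.linear sc (*) m"
  proof -
    interpret C: vector_space "(*) :: complex \<Rightarrow> complex \<Rightarrow> complex"
      by standard (simp_all add: algebra_simps)
    show ?thesis
      by (intro Vector_Spaces.linear.intro module_hom.intro module_hom_axioms.intro)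
         (unfold_locales; simp add: add scale)+
  qed
  then show ?thesis using that prod norm by blast
qed

section \<open>Characters and continuous seminorms\<close>

lemma seminorm_topology_functional_continuous:
  fixes m :: "'a::ring \<Rightarrow> complex"
  assumes lin: "Vector_Spaces.linear sc (*) m" and \<alpha>: "\<alpha> \<in> \<Lambda>"
    and le: "\<And>x. cmod (m x) \<le> p \<alpha> x" and p0: "p \<alpha> 0 = 0"
  shows "continuous_map (seminorm_topology \<Lambda> p) euclidean m"
  unfolding continuous_map_def
proof (intro conjI allI impI)
  have top: "topspace (seminorm_topology \<Lambda> p) = UNIV"
    by (auto simp: seminorm_topology_def)
  show "m \<in> topspace (seminorm_topology \<Lambda> p) \<rightarrow> topspace euclidean" by simp
  fix U :: "complex set" assume "openin euclidean U"
  then have U: "open U" by simp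
  show "openin (seminorm_topology \<Lambda> p) {x \<in> topspace (seminorm_topology \<Lambda> p). m x \<in> U}"
    unfolding top
  proof (subst openin_subopen, intro ballI)
    fix x assume "x \<in> {x \<in> UNIV. m x \<in> U}"
    then obtain e where e: "0 < e" "ball (m x) e \<subseteq> U"
      using U by (auto simp: open_contains_ball)
    have diff: "m (y - x) = m y - m x" for y
      using lin by (simp add: Vector_Spaces.linear_iff_module_hom module_hom.diff)
    have "openin (seminorm_topology \<Lambda> p) {y. p \<alpha> (y - x) < e}"
      unfolding seminorm_topology_def using \<alpha> e(1)
      by (intro topology_generated_by_Basis) blast
    moreover have "{y. p \<alpha> (y - x) < e} \<subseteq> {x \<in> UNIV. m x \<in> U}"
    proof
      fix y assume "y \<in> {y. p \<alpha> (y - x) < e}"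
      then have "dist (m x) (m y) < e"
        using le[of "y - x"] by (simp add: diff dist_norm norm_minus_commute)
      then show "y \<in> {x \<in> UNIV. m x \<in> U}" using e(2) by auto
    qed
    ultimately show "\<exists>W. openin (seminorm_topology \<Lambda> p) W \<and> x \<in> W \<and> W \<subseteq> {x \<in> UNIV. m x \<in> U}"
      using e(1) p0 by (intro exI[of _ "{y. p \<alpha> (y - x) < e}"]) auto
  qed
qed

context
  fixes sc :: "complex \<Rightarrow> 'a::comm_ring_1 \<Rightarrow> 'a" and T :: "'a topology"
    and q :: "'a \<Rightarrow> real" and m :: "'a \<Rightarrow> complex"
  assumes sem: "seminorm sc q" and sub: "submultiplicative q" and q1: "q 1 = 1"
    and m: "m \<in> carrier_space sc T"
begin

lemma character_mult: "m (x * y) = m x * m y"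
  using m by (simp add: carrier_space_def)

lemma character_scale: "m (sc c x) = c * m x"
  using m by (simp add: carrier_space_def Vector_Spaces.linear_iff_module_hom module_hom.scale)

lemma character_one: "m 1 = 1"
proof -
  obtain x where "m x \<noteq> 0" using m by (auto simp: carrier_space_def fun_eq_iff)
  with character_mult[of 1 x] show ?thesis by simp
qed

lemma functional_bound_character_ge_1: "1 \<le> functional_bound q m"
proof -
  have "ereal (cmod (m 1)) \<le> functional_bound q m"
    unfolding functional_bound_def by (rule SUP_upper) (simp add: q1)
  then show ?thesis by (simp add: character_one one_ereal_def)
qed

text \<open>A character bounded on the unit ball of a submultiplicative seminorm is bounded by \<open>1\<close> there,
  because the unit ball is closed under powers.\<close>

lemma functional_bound_character_finite:
  assumes fin: "functional_bound q m < \<infinity>"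
  shows "functional_bound q m = 1" "cmod (m x) \<le> q x"
proof -
  obtain C where C: "functional_bound q m = ereal C"
    using fin functional_bound_character_ge_1 by (cases "functional_bound q m") auto
  have bounded: "cmod (m y) \<le> C" if "q y \<le> 1" for y
    using that SUP_upper[of y "{x. q x \<le> 1}" "\<lambda>x. ereal (cmod (m x))"] C
    by (simp add: functional_bound_def)
  have le1: "cmod (m y) \<le> 1" if "q y \<le> 1" for y
  proof (rule ccontr)
    assume "\<not> cmod (m y) \<le> 1"
    then obtain n where n: "C < cmod (m y) ^ n"
      using real_arch_pow[of "cmod (m y)" C] by auto
    have "q (y ^ n) \<le> 1"
    proof (induction n)
      case (Suc n)
      have "q (y ^ Suc n) \<le> q y * q (y ^ n)"
        using submultiplicativeD[OF sub, of y "y ^ n"] by simp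
      also have "\<dots> \<le> 1"
        using that Suc seminormD(1)[OF sem] by (simp add: mult_le_one)
      finally show ?case .
    qed (simp add: q1)
    moreover have "m (y ^ n) = m y ^ n"
      by (induction n) (simp_all add: character_one character_mult)
    ultimately show False using bounded[of "y ^ n"] n by (simp add: norm_power)
  qed
  have "functional_bound q m \<le> 1"
    unfolding functional_bound_def by (rule SUP_least) (simp add: le1 one_ereal_def)
  with functional_bound_character_ge_1 show "functional_bound q m = 1" by simp
  show "cmod (m x) \<le> q x"
  proof (rule dense_ge)
    fix r assume r: "q x < r"
    then have "0 < r" using seminormD(1)[OF sem, of x] by simp
    then have "cmod (m (sc (of_real (inverse r)) x)) \<le> 1"
      using r by (intro le1) (simp add: seminormD(3)[OF sem] norm_inverse norm_divide field_simps)
    with \<open>0 < r\<close> show "cmod (m x) \<le> r"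
      by (simp add: character_scale norm_mult norm_inverse norm_divide field_simps)
  qed
qed

lemma weight_character: "weight q m = (if functional_bound q m < \<infinity> then 1 else 0)"
proof (cases "functional_bound q m < \<infinity>")
  case True
  then show ?thesis by (simp add: weight_def functional_bound_character_finite(1)[OF True])
qed (simp add: weight_def)

lemma weighted_character_le: "weight q m * cmod (m x) \<le> q x"
  using functional_bound_character_finite(2) seminormD(1)[OF sem] by (simp add: weight_character)

end

section \<open>The equivalence\<close>

theorem proposition2p9:
  fixes sc :: "complex \<Rightarrow> 'a::comm_ring_1 \<Rightarrow> 'a"
    and T :: "'a topology"
    and \<Lambda> :: "'i set"
    and p :: "'i \<Rightarrow> 'a \<Rightarrow> real"
  assumes "uniformly_A_convex_algebra sc T \<Lambda> p"
    and "Hausdorff_space T"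
    and "\<forall>\<alpha>\<in>\<Lambda>. p \<alpha> 1 = 1"
    and "carrier_space sc T \<noteq> {}"
    and "\<forall>\<alpha>\<in>\<Lambda>. submultiplicative (p \<alpha>)"
  shows "(saturated sc T \<Lambda> p \<longleftrightarrow> Cochran_algebra sc T \<Lambda> p) \<and>
         (Cochran_algebra sc T \<Lambda> p \<longleftrightarrow> uniform_topological_algebra sc \<Lambda> p)"
proof -
  have alg: "complex_algebra sc" and sem: "\<And>\<alpha>. \<alpha> \<in> \<Lambda> \<Longrightarrow> seminorm sc (p \<alpha>)"
    and T: "T = seminorm_topology \<Lambda> p"
    using assms(1) by (auto simp: uniformly_A_convex_algebra_def locally_convex_algebra_def)
  interpret complex_algebra sc by (rule alg)
  have sub: "\<And>\<alpha>. \<alpha> \<in> \<Lambda> \<Longrightarrow> submultiplicative (p \<alpha>)"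
    and p1: "\<And>\<alpha>. \<alpha> \<in> \<Lambda> \<Longrightarrow> p \<alpha> 1 = 1" using assms by auto
  let ?M = "carrier_space sc T"
  have "Cochran_algebra sc T \<Lambda> p" if sat: "saturated sc T \<Lambda> p"
    unfolding Cochran_algebra_def
  proof (intro ballI allI)
    fix \<alpha> x assume \<alpha>: "\<alpha> \<in> \<Lambda>"
    note hyps = sem[OF \<alpha>] sub[OF \<alpha>] p1[OF \<alpha>]
    have "ereal (p \<alpha> x) \<le> weighted_sup ?M (p \<alpha>) (gelfand x)"
    proof (cases "p \<alpha> x = 0")
      case True
      obtain m where m: "m \<in> ?M" using assms(4) by auto
      have "0 \<le> ereal (weight (p \<alpha>) m * cmod (gelfand x m))"
        using weight_character[OF hyps m] by simp
      then show ?thesis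
        unfolding weighted_sup_def True zero_ereal_def[symmetric] by (rule SUP_upper2[OF m])
    next
      case False
      define r where "r = p \<alpha> x"
      have r: "0 < r" using False seminormD(1)[OF sem[OF \<alpha>], of x] by (simp add: r_def)
      have "p \<alpha> (sc (of_real (inverse r)) x) = 1"
        using r by (simp add: seminormD(3)[OF sem[OF \<alpha>]] norm_inverse flip: r_def)
      then obtain m where m: "m \<in> ?M"
        and eq: "ereal (cmod (m (sc (of_real (inverse r)) x))) = functional_bound (p \<alpha>) m"
        using sat \<alpha> unfolding saturated_def by blast
      from eq have fin: "functional_bound (p \<alpha>) m < \<infinity>"
        by (metis less_ereal.simps(4))
      have "cmod (m (sc (of_real (inverse r)) x)) = 1"
        using eq functional_bound_character_finite(1)[OF hyps m fin] by (simp add: one_ereal_def)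
      then have "cmod (m x) = r"
        using r by (simp add: character_scale[OF hyps m] norm_mult norm_inverse norm_divide field_simps)
      then have "ereal (p \<alpha> x) \<le> ereal (weight (p \<alpha>) m * cmod (gelfand x m))"
        using fin by (simp add: weight_character[OF hyps m] gelfand_def r_def)
      then show ?thesis
        unfolding weighted_sup_def by (rule SUP_upper2[OF m])
    qed
    moreover have "weighted_sup ?M (p \<alpha>) (gelfand x) \<le> ereal (p \<alpha> x)"
      unfolding weighted_sup_def gelfand_def
      by (rule SUP_least) (simp add: weighted_character_le[OF hyps])
    ultimately show "weighted_sup ?M (p \<alpha>) (gelfand x) = ereal (p \<alpha> x)" by simp
  qed
  moreover have "uniform_topological_algebra sc \<Lambda> p" if coch: "Cochran_algebra sc T \<Lambda> p"
    unfolding uniform_topological_algebra_def uniform_seminorm_def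
  proof (intro ballI allI conjI sem)
    fix \<alpha> x assume \<alpha>: "\<alpha> \<in> \<Lambda>"
    note hyps = sem[OF \<alpha>] sub[OF \<alpha>] p1[OF \<alpha>]
    have nonneg: "0 \<le> p \<alpha> y" for y by (rule seminormD(1)[OF sem[OF \<alpha>]])
    have sup: "(SUP m\<in>?M. ereal (weight (p \<alpha>) m * cmod (m y))) = ereal (p \<alpha> y)" for y
      using coch \<alpha> by (simp add: Cochran_algebra_def weighted_sup_def gelfand_def)
    \<comment> \<open>The weights are \<open>0\<close> or \<open>1\<close>, so every weighted value at \<open>x * x\<close> is the square of that at \<open>x\<close>.\<close>
    have "ereal (p \<alpha> x) \<le> ereal (sqrt (p \<alpha> (x * x)))"
      unfolding sup[symmetric, of x]
    proof (rule SUP_least)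
      fix m assume m: "m \<in> ?M"
      have "(weight (p \<alpha>) m * cmod (m x))\<^sup>2 = weight (p \<alpha>) m * cmod (m (x * x))"
        by (simp add: weight_character[OF hyps m] character_mult[OF hyps m] norm_mult
            power2_eq_square)
      also have "\<dots> \<le> p \<alpha> (x * x)" by (rule weighted_character_le[OF hyps m])
      finally show "ereal (weight (p \<alpha>) m * cmod (m x)) \<le> ereal (sqrt (p \<alpha> (x * x)))"
        by (simp add: real_le_rsqrt)
    qed
    then have "(p \<alpha> x)\<^sup>2 \<le> p \<alpha> (x * x)"
      using nonneg by (simp add: real_le_rsqrt sqrt_ge_absD)
    moreover have "p \<alpha> (x * x) \<le> (p \<alpha> x)\<^sup>2"
      using submultiplicativeD[OF sub[OF \<alpha>], of x x] by (simp add: power2_eq_square)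
    ultimately show "p \<alpha> (x * x) = (p \<alpha> x)\<^sup>2" by simp
  qed
  moreover have "saturated sc T \<Lambda> p" if unif: "uniform_topological_algebra sc \<Lambda> p"
    unfolding saturated_def
  proof (intro ballI allI impI)
    fix \<alpha> x assume \<alpha>: "\<alpha> \<in> \<Lambda>" and x: "p \<alpha> x = 1"
    note hyps = sem[OF \<alpha>] sub[OF \<alpha>] p1[OF \<alpha>]
    have "uniform_seminorm sc (p \<alpha>)"
      using unif \<alpha> by (simp add: uniform_topological_algebra_def)
    then obtain q where q: "seminorm sc q" "\<And>a b. q (a * b) = q a * q b"
        "\<And>a. q a \<le> p \<alpha> a" "q x = 1"
      using multiplicative_seminorm_below_uniform[OF alg _ sub[OF \<alpha>] x] by metis
    have q1: "q 1 = 1" using q(2)[of x 1] q(4) by simp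
    obtain m where lin: "Vector_Spaces.linear sc (*) m"
      and mult: "\<And>a b. m (a * b) = m a * m b" and norm: "\<And>a. cmod (m a) = q a"
      using character_of_multiplicative_seminorm[OF alg q(1,2) q1] by metis
    have le: "cmod (m y) \<le> p \<alpha> y" for y using norm q(3) by simp
    have "p \<alpha> 0 = 0" using seminormD(3)[OF sem[OF \<alpha>], of 0 0] by simp
    then have "continuous_map T euclidean m"
      unfolding T
      using seminorm_topology_functional_continuous[where p = p, OF lin \<alpha>] le by blast
    moreover have "m \<noteq> (\<lambda>x. 0)" using norm[of x] q(4) by auto
    ultimately have m: "m \<in> ?M" using lin mult by (simp add: carrier_space_def)
    have "functional_bound (p \<alpha>) m \<le> 1"
      unfolding functional_bound_def
      by (rule SUP_least) (use le order_trans in \<open>auto simp: one_ereal_def\<close>)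
    then have "functional_bound (p \<alpha>) m = ereal (cmod (m x))"
      using functional_bound_character_ge_1[OF hyps m] by (simp add: norm q(4) one_ereal_def)
    with m show "\<exists>m\<in>?M. ereal (cmod (m x)) = functional_bound (p \<alpha>) m" by metis
  qed
  ultimately show ?thesis by blast
qed

end
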